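(* Let $\Pi$ be a DatalogMTL$^{FP}$ program and $D$ a database. For each predicate $P$ in $\Pi$ there exist a time point $T$ and a positive integer $n$ such that for all $x\in\mathbb N$ and all tuples $\boldsymbol\tau$: $P(\boldsymbol\tau)@(T+n x)\in\Pi(D)$ iff $P(\boldsymbol\tau)@T\in\Pi(D)$.
   Context: DatalogMTL over $\mathbb Q$ with continuous semantics. A DatalogMTL$^{FP}$ (forward propagating) program is a finite set of rules of the forms $P_1(\boldsymbol\tau_1)\land\dots\land P_n(\boldsymbol\tau_n)\to P_0(\boldsymbol\tau_0)$ ($n\ge0$), $\boxminus_\varrho P_1(\boldsymbol\tau_1)\to P_0(\boldsymbol\tau_0)$ and $\Diamond^-_\varrho P_1(\boldsymbol\tau_1)\to P_0(\boldsymbol\tau_0)$ with non-negative intervals $\varrho$; $\mathfrak M,t\models\boxminus_\varrho A$ iff $A$ holds at all $s$ with $t-s\in\varrho$, and $\mathfrak M,t\models\Diamond^-_\varrho A$ iff $A$ holds at some $s$ with $t-s\in\varrho$. A rule is satisfied if for every grounding and time $t$, body true at $t$ implies head true at $t$. A database is a finite set of facts $A@\varrho$ ($A$ ground atom, $\varrho$ interval). $\Pi(D)$ is the minimum model of $\Pi$ and $D$, and $P(\boldsymbol\tau)@t\in\Pi(D)$ means the ground atom holds at $t$ in it. *)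

theory Defs
  imports Complex_Main
begin

(* Nonempty intervals of the rational time line with endpoints in the rationals extended by
   plus and minus infinity. *)
definition rat_interval :: "rat set \<Rightarrow> bool" where
  "rat_interval I \<longleftrightarrow> I \<noteq> {} \<and>
     (I = UNIV \<or>
      (\<exists>a. I = {a..} \<or> I = {a<..} \<or> I = {..a} \<or> I = {..<a}) \<or>
      (\<exists>a b. I = {a..b} \<or> I = {a..<b} \<or> I = {a<..b} \<or> I = {a<..<b}))"

datatype ('v, 'c) trm = Var 'v | Const 'c

type_synonym ('p, 'a) atom = "'p \<times> 'a list"

datatype ('p, 'v, 'c) body =
    Conj "('p, ('v, 'c) trm) atom list"
  | BoxMinus "rat set" "('p, ('v, 'c) trm) atom"
  | DiamondMinus "rat set" "('p, ('v, 'c) trm) atom"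

datatype ('p, 'v, 'c) mtl_rule =
  Rule (body_of: "('p, 'v, 'c) body") (head_of: "('p, ('v, 'c) trm) atom")

fun body_atoms :: "('p, 'v, 'c) body \<Rightarrow> ('p, ('v, 'c) trm) atom set" where
  "body_atoms (Conj As) = set As"
| "body_atoms (BoxMinus \<rho> A) = {A}"
| "body_atoms (DiamondMinus \<rho> A) = {A}"

definition rule_atoms :: "('p, 'v, 'c) mtl_rule \<Rightarrow> ('p, ('v, 'c) trm) atom set" where
  "rule_atoms r = insert (head_of r) (body_atoms (body_of r))"

definition program_preds :: "('p, 'v, 'c) mtl_rule set \<Rightarrow> 'p set" where
  "program_preds \<Pi> = (\<Union>r\<in>\<Pi>. fst ` rule_atoms r)"

definition wf_atom :: "('p \<Rightarrow> nat) \<Rightarrow> ('p, 'a) atom \<Rightarrow> bool" where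
  "wf_atom ar A \<longleftrightarrow> length (snd A) = ar (fst A)"

fun forward_body :: "('p, 'v, 'c) body \<Rightarrow> bool" where
  "forward_body (Conj As) \<longleftrightarrow> True"
| "forward_body (BoxMinus \<rho> A) \<longleftrightarrow> rat_interval \<rho> \<and> \<rho> \<subseteq> {0..}"
| "forward_body (DiamondMinus \<rho> A) \<longleftrightarrow> rat_interval \<rho> \<and> \<rho> \<subseteq> {0..}"

(* Rules need not be safe: a head variable is allowed not to occur in the body. *)
definition fp_program :: "('p \<Rightarrow> nat) \<Rightarrow> ('p, 'v, 'c) mtl_rule set \<Rightarrow> bool" where
  "fp_program ar \<Pi> \<longleftrightarrow> finite \<Pi> \<and>
     (\<forall>r\<in>\<Pi>. forward_body (body_of r) \<and> (\<forall>A\<in>rule_atoms r. wf_atom ar A))"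

definition database :: "('p \<Rightarrow> nat) \<Rightarrow> (('p, 'c) atom \<times> rat set) set \<Rightarrow> bool" where
  "database ar D \<longleftrightarrow> finite D \<and> (\<forall>(A, \<rho>)\<in>D. wf_atom ar A \<and> rat_interval \<rho>)"

(* An interpretation is the set of all pairs (A, t) such that the ground atom A holds at time t. *)
type_synonym ('p, 'c) interp = "(('p, 'c) atom \<times> rat) set"

fun ground_trm :: "('v \<Rightarrow> 'c) \<Rightarrow> ('v, 'c) trm \<Rightarrow> 'c" where
  "ground_trm \<sigma> (Var v) = \<sigma> v"
| "ground_trm \<sigma> (Const c) = c"

definition ground_atom :: "('v \<Rightarrow> 'c) \<Rightarrow> ('p, ('v, 'c) trm) atom \<Rightarrow> ('p, 'c) atom" where
  "ground_atom \<sigma> A = (fst A, map (ground_trm \<sigma>) (snd A))"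

fun sat_body ::
  "('p, 'c) interp \<Rightarrow> rat \<Rightarrow> ('v \<Rightarrow> 'c) \<Rightarrow> ('p, 'v, 'c) body \<Rightarrow> bool" where
  "sat_body M t \<sigma> (Conj As) \<longleftrightarrow> (\<forall>A\<in>set As. (ground_atom \<sigma> A, t) \<in> M)"
| "sat_body M t \<sigma> (BoxMinus \<rho> A) \<longleftrightarrow> (\<forall>s. t - s \<in> \<rho> \<longrightarrow> (ground_atom \<sigma> A, s) \<in> M)"
| "sat_body M t \<sigma> (DiamondMinus \<rho> A) \<longleftrightarrow> (\<exists>s. t - s \<in> \<rho> \<and> (ground_atom \<sigma> A, s) \<in> M)"

definition sat_rule :: "('p, 'c) interp \<Rightarrow> ('p, 'v, 'c) mtl_rule \<Rightarrow> bool" where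
  "sat_rule M r \<longleftrightarrow>
     (\<forall>\<sigma> t. sat_body M t \<sigma> (body_of r) \<longrightarrow> (ground_atom \<sigma> (head_of r), t) \<in> M)"

definition is_model ::
  "('p, 'v, 'c) mtl_rule set \<Rightarrow> (('p, 'c) atom \<times> rat set) set \<Rightarrow> ('p, 'c) interp \<Rightarrow> bool" where
  "is_model \<Pi> D M \<longleftrightarrow> (\<forall>r\<in>\<Pi>. sat_rule M r) \<and> (\<forall>(A, \<rho>)\<in>D. \<forall>t\<in>\<rho>. (A, t) \<in> M)"

definition min_model ::
  "('p, 'v, 'c) mtl_rule set \<Rightarrow> (('p, 'c) atom \<times> rat set) set \<Rightarrow> ('p, 'c) interp" where
  "min_model \<Pi> D = (LEAST M. is_model \<Pi> D M)"

lemma sat_body_mono: "sat_body M t \<sigma> b \<Longrightarrow> M \<subseteq> N \<Longrightarrow> sat_body N t \<sigma> b"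
  by (cases b) auto

lemma is_model_Inter: "is_model \<Pi> D (\<Inter>{M. is_model \<Pi> D M})"
proof -
  let ?I = "\<Inter>{M. is_model \<Pi> D M}"
  have "sat_rule ?I r" if r: "r \<in> \<Pi>" for r
    unfolding sat_rule_def
  proof (intro allI impI InterI)
    fix \<sigma> t M
    assume b: "sat_body ?I t \<sigma> (body_of r)" and "M \<in> {M. is_model \<Pi> D M}"
    then have M: "is_model \<Pi> D M" by simp
    then have "?I \<subseteq> M" by blast
    with b have "sat_body M t \<sigma> (body_of r)" by (rule sat_body_mono)
    with M r show "(ground_atom \<sigma> (head_of r), t) \<in> M"
      unfolding is_model_def sat_rule_def by blast
  qed
  moreover have "\<forall>(A, \<rho>)\<in>D. \<forall>t\<in>\<rho>. (A, t) \<in> ?I"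
    by (auto simp: is_model_def)
  ultimately show ?thesis by (simp add: is_model_def)
qed

lemma min_model_eq_Inter: "min_model \<Pi> D = \<Inter>{M. is_model \<Pi> D M}"
  unfolding min_model_def
  by (rule Least_equality, rule is_model_Inter) auto

lemma is_model_min_model: "is_model \<Pi> D (min_model \<Pi> D)"
  using is_model_Inter by (simp add: min_model_eq_Inter)

lemma min_model_least: "is_model \<Pi> D M \<Longrightarrow> min_model \<Pi> D \<subseteq> M"
  by (auto simp: min_model_eq_Inter)

end

theory Submission
  imports Defs
begin

text \<open>
  Let \<open>M\<close> be the minimum model. Choose \<open>d\<close> so that all interval endpoints are multiples of \<open>1 / d\<close>.
  The set of facts that hold on the whole cell of their time point (a multiple of \<open>1 / d\<close> or an
  open interval between two neighbouring ones) is again a model, so \<open>M\<close> is constant on cells.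
  Since \<open>M\<close> is closed under all maps that fix the finitely many named constants, the times at
  which an atom holds depend only on its predicate and on the equality pattern of its arguments,
  so even over an infinite domain only finitely many sets of times arise. Hence two windows
  \<open>[k - w, k)\<close> of \<open>M\<close> at different integers \<open>k\<close> agree. If \<open>w\<close> exceeds all finite endpoints in the
  program, and \<open>k - w\<close> lies beyond those of the database and beyond a time before which every atom
  that ever holds (fails) has held (failed), then gluing \<open>M\<close> before one of the two points to \<open>M\<close> from
  the other one onwards gives a model. Minimality of \<open>M\<close>, used in both directions, makes
  the two futures equal.
\<close>

section \<open>Cells of the rational time line\<close>

text \<open>For positive \<open>d\<close>, floor and ceiling coincide exactly at the multiples of
  \<open>1 / d\<close>. The floor alone would merge such a point with the open interval to its
  right.\<close>

definition cell :: "nat \<Rightarrow> rat \<Rightarrow> int \<times> int" where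
  "cell d t = (\<lfloor>of_nat d * t\<rfloor>, \<lceil>of_nat d * t\<rceil>)"

definition saturated :: "nat \<Rightarrow> rat set \<Rightarrow> bool" where
  "saturated d I \<longleftrightarrow> (\<forall>x y. cell d x = cell d y \<longrightarrow> x \<in> I \<longrightarrow> y \<in> I)"

lemma saturatedD: "saturated d I \<Longrightarrow> cell d x = cell d y \<Longrightarrow> x \<in> I \<Longrightarrow> y \<in> I"
  unfolding saturated_def by blast

text \<open>With \<open>of_nat d * a\<close> an integer \<open>z\<close>, comparing \<open>u\<close>
  with \<open>a\<close> amounts to comparing the ceiling or the floor of \<open>of_nat d * u\<close>
  with \<open>z\<close>, and the cell records both.\<close>

lemma cell_threshold:
  assumes "d > 0" and "of_nat d * a \<in> \<int>" and "cell d x = cell d y"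
  shows "x \<le> a \<longleftrightarrow> y \<le> a" and "a \<le> x \<longleftrightarrow> a \<le> y"
proof -
  obtain z :: int where z: "of_nat d * a = of_int z"
    using assms(2) by (auto elim: Ints_cases)
  have d: "(of_nat d :: rat) > 0"
    using assms(1) by simp
  have "u \<le> a \<longleftrightarrow> \<lceil>of_nat d * u\<rceil> \<le> z" "a \<le> u \<longleftrightarrow> z \<le> \<lfloor>of_nat d * u\<rfloor>" for u
    using d by (simp_all add: ceiling_le_iff le_floor_iff flip: z)
  then show "x \<le> a \<longleftrightarrow> y \<le> a" "a \<le> x \<longleftrightarrow> a \<le> y"
    using assms(3) by (simp_all add: cell_def)
qed

lemma common_denominator:
  fixes E :: "rat set"
  assumes "finite E"
  shows "\<exists>d::nat. d > 0 \<and> (\<forall>a\<in>E. of_nat d * a \<in> \<int>)"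
  using assms
proof (induction E)
  case empty
  show ?case by (auto intro: exI[of _ 1])
next
  case (insert a E)
  then obtain d :: nat where d: "d > 0" "\<forall>a\<in>E. of_nat d * a \<in> \<int>"
    by blast
  obtain p q :: int where pq: "a = of_int p / of_int q" "q > 0"
    by (cases a) (auto simp: Fract_of_int_quotient)
  have "of_nat (d * nat q) * b \<in> \<int>" if "b \<in> E" for b
  proof -
    have "of_nat (d * nat q) * b = of_int q * (of_nat d * b)"
      using pq by simp
    then show ?thesis
      using d that by (metis Ints_mult Ints_of_int)
  qed
  moreover have "of_nat (d * nat q) * a = of_int (int d * p)"
    using pq by simp
  ultimately have "\<forall>b\<in>insert a E. of_nat (d * nat q) * b \<in> \<int>"
    by (metis Ints_of_int insert_iff)
  moreover have "d * nat q > 0"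
    using d pq by simp
  ultimately show ?case by blast
qed

text \<open>\<open>E\<close> collects the finite endpoints. Leaving \<open>d\<close> arbitrary lets
  one common denominator serve many intervals later.\<close>

lemma saturated_of_thresholds:
  assumes "rat_interval I"
  shows "\<exists>E. finite (E :: rat set) \<and> (\<forall>d>0. (\<forall>a\<in>E. of_nat d * a \<in> \<int>) \<longrightarrow> saturated d I)"
proof -
  have *: "\<exists>E. finite (E :: rat set) \<and> (\<forall>d>0. (\<forall>a\<in>E. of_nat d * a \<in> \<int>) \<longrightarrow> saturated d I)"
    if "\<And>x y. x \<le> a \<longleftrightarrow> y \<le> a \<Longrightarrow> a \<le> x \<longleftrightarrow> a \<le> y \<Longrightarrow> x \<le> b \<longleftrightarrow> y \<le> b
      \<Longrightarrow> b \<le> x \<longleftrightarrow> b \<le> y \<Longrightarrow> x \<in> I \<Longrightarrow> y \<in> I" for a b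
  proof (intro exI[of _ "{a, b}"] conjI allI impI)
    fix d :: nat
    assume d: "d > 0" "\<forall>a\<in>{a, b}. of_nat d * a \<in> \<int>"
    show "saturated d I"
      unfolding saturated_def
    proof (intro allI impI)
      fix x y
      assume "cell d x = cell d y" "x \<in> I"
      then show "y \<in> I"
        using d that[of x y] cell_threshold[of d a x y] cell_threshold[of d b x y] by blast
    qed
  qed simp
  from assms consider "I = UNIV" | a where "I = {a..} \<or> I = {a<..} \<or> I = {..a} \<or> I = {..<a}"
    | a b where "I = {a..b} \<or> I = {a..<b} \<or> I = {a<..b} \<or> I = {a<..<b}"
    unfolding rat_interval_def by blast
  then show ?thesis
  proof cases
    case 1
    then show ?thesis by (intro *) auto
  next
    case (2 a)
    then show ?thesis by (intro *[of a a]) (auto simp flip: not_le)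
  next
    case (3 a b)
    then show ?thesis by (intro *[of a b]) (auto simp flip: not_le)
  qed
qed

lemma common_saturation:
  assumes "finite \<I>" and "\<forall>I\<in>\<I>. rat_interval I"
  shows "\<exists>d>0. \<forall>I\<in>\<I>. saturated d I"
proof -
  obtain E :: "rat set \<Rightarrow> rat set" where E: "\<forall>I\<in>\<I>. finite (E I) \<and>
      (\<forall>d>0. (\<forall>a\<in>E I. of_nat d * a \<in> \<int>) \<longrightarrow> saturated d I)"
    using bchoice[of \<I>] saturated_of_thresholds assms(2) by metis
  then have "finite (\<Union>I\<in>\<I>. E I)"
    using assms(1) by blast
  then show ?thesis
    using common_denominator E by (metis UN_iff)
qed

text \<open>Beyond its finite endpoints an interval is either exhausted or contains everything. This
  applies both to offsets in rules and to times in the database.\<close>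

lemma rat_interval_tail:
  assumes "rat_interval I"
  shows "\<exists>w. \<forall>v\<ge>w. I \<subseteq> {..<v} \<or> {v..} \<subseteq> I"
proof -
  from assms consider "I = UNIV" | a where "I = {a..} \<or> I = {a<..} \<or> I = {..a} \<or> I = {..<a}"
    | a b where "I = {a..b} \<or> I = {a..<b} \<or> I = {a<..b} \<or> I = {a<..<b}"
    unfolding rat_interval_def by blast
  then show ?thesis
  proof cases
    case 1
    then show ?thesis by simp
  next
    case (2 a)
    then show ?thesis by (intro exI[of _ "a + 1"]) auto
  next
    case (3 a b)
    then show ?thesis by (intro exI[of _ "b + 1"]) auto
  qed
qed

lemma finite_uniform_bound:
  fixes Q :: "'a \<Rightarrow> rat \<Rightarrow> bool"
  assumes "finite X" and "\<And>x. x \<in> X \<Longrightarrow> \<exists>w. \<forall>v\<ge>w. Q x v"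
  shows "\<exists>w. \<forall>v\<ge>w. \<forall>x\<in>X. Q x v"
  using eventually_ball_finite[of X "\<lambda>v x. Q x v" at_top] assms
  by (auto simp: eventually_at_top_linorder)

text \<open>For non-integral \<open>x\<close> and \<open>y\<close>, the cell of \<open>x - y\<close>
  depends only on their integer parts and on the order of their fractional parts. So when
  \<open>x\<close> moves inside its cell, \<open>y\<close> can follow inside its own. This is what
  transports metric operators between times of one cell.\<close>

lemma cell_difference:
  assumes "cell d t = cell d t'" and "d > 0"
  shows "\<exists>s'. cell d s' = cell d s \<and> cell d (t' - s') = cell d (t - s)"
proof -
  define x x' y where "x = of_nat d * t" and "x' = of_nat d * t'" and "y = of_nat d * s"
  have xx: "\<lfloor>x\<rfloor> = \<lfloor>x'\<rfloor>" "\<lceil>x\<rceil> = \<lceil>x'\<rceil>"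
    using assms(1) by (auto simp: cell_def x_def x'_def)
  have "\<exists>y'. \<lfloor>y'\<rfloor> = \<lfloor>y\<rfloor> \<and> \<lceil>y'\<rceil> = \<lceil>y\<rceil> \<and> \<lfloor>x' - y'\<rfloor> = \<lfloor>x - y\<rfloor> \<and> \<lceil>x' - y'\<rceil> = \<lceil>x - y\<rceil>"
  proof (cases "x \<in> \<int> \<or> y \<in> \<int>")
    case True
    \<comment> \<open>An integer \<open>x\<close> is alone in its cell, so \<open>x' = x\<close>.
      For an integer \<open>y\<close>, subtraction merely shifts floor and ceiling, so
      \<open>y\<close> itself is the witness.\<close>
    then show ?thesis
    proof
      assume "x \<in> \<int>"
      then have "x = of_int \<lfloor>x\<rfloor>" "\<lfloor>x\<rfloor> = \<lceil>x\<rceil>"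
        by (auto elim: Ints_cases)
      then have "x' = x"
        using xx by (metis antisym le_of_int_ceiling of_int_floor_le)
      then show ?thesis by blast
    next
      assume "y \<in> \<int>"
      then show ?thesis
        using xx by (auto elim!: Ints_cases intro!: exI[of _ y])
    qed
  next
    case False
    define m k u u' v where "m = \<lfloor>x\<rfloor>" and "k = \<lfloor>y\<rfloor>" and "u = frac x" and "u' = frac x'"
      and "v = frac y"
    have "x' \<notin> \<int>"
    proof
      assume "x' \<in> \<int>"
      then have "\<lfloor>x'\<rfloor> = \<lceil>x'\<rceil>"
        by (auto elim: Ints_cases)
      then have "of_int \<lfloor>x\<rfloor> = x"
        using xx by (metis antisym le_of_int_ceiling of_int_floor_le)
      with False show False by (metis Ints_of_int)
    qed
    then have uv: "0 < u" "u < 1" "0 < u'" "u' < 1" "0 < v" "v < 1"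
      using False by (auto simp: u_def u'_def v_def frac_gt_0_iff frac_lt_1)
    have eq: "x = of_int m + u" "x' = of_int m + u'" "y = of_int k + v"
      using xx by (auto simp: m_def k_def u_def u'_def v_def frac_def)
    \<comment> \<open>Any point of the open unit interval would do that lies on the same side of
      \<open>u'\<close> as \<open>v\<close> does of \<open>u\<close>.\<close>
    define v' where "v' = (if v = u then u' else if v < u then u' / 2 else (u' + 1) / 2)"
    define y' where "y' = of_int k + v'"
    have v': "0 < v'" "v' < 1" "v = u \<longleftrightarrow> v' = u'" "v < u \<longleftrightarrow> v' < u'"
      using uv by (auto simp: v'_def)
    have fl: "\<lfloor>of_int j + r\<rfloor> = j" "\<lceil>of_int j + r\<rceil> = j + 1" if "0 < r" "r < 1" for r :: rat and j
      using that by linarith+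
    have fy: "\<lfloor>y'\<rfloor> = \<lfloor>y\<rfloor>" "\<lceil>y'\<rceil> = \<lceil>y\<rceil>"
      using fl v' uv by (simp_all add: eq y'_def)
    \<comment> \<open>The second pair of equations borrows one from the integer part, for the case
      that \<open>u - v\<close> is negative.\<close>
    have *: "x - y = of_int (m - k) + (u - v)" "x' - y' = of_int (m - k) + (u' - v')"
      "x - y = of_int (m - k - 1) + (u - v + 1)" "x' - y' = of_int (m - k - 1) + (u' - v' + 1)"
      by (simp_all add: eq y'_def)
    have "\<lfloor>x' - y'\<rfloor> = \<lfloor>x - y\<rfloor> \<and> \<lceil>x' - y'\<rceil> = \<lceil>x - y\<rceil>"
    proof (cases v u rule: linorder_cases)
      case less
      then have "0 < u - v" "u - v < 1" "0 < u' - v'" "u' - v' < 1"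
        using uv v' by auto
      then show ?thesis
        unfolding *(1,2) using fl by metis
    next
      case equal
      then show ?thesis
        unfolding *(1,2) using v' by simp
    next
      case greater
      then have "0 < u - v + 1" "u - v + 1 < 1" "0 < u' - v' + 1" "u' - v' + 1 < 1"
        using uv v' by auto
      then show ?thesis
        unfolding *(3,4) using fl by metis
    qed
    then show ?thesis
      using fy by blast
  qed
  then obtain y' where "\<lfloor>y'\<rfloor> = \<lfloor>y\<rfloor>" "\<lceil>y'\<rceil> = \<lceil>y\<rceil>" "\<lfloor>x' - y'\<rfloor> = \<lfloor>x - y\<rfloor>" "\<lceil>x' - y'\<rceil> = \<lceil>x - y\<rceil>"
    by blast
  then show ?thesis
    using assms(2)
    by (intro exI[of _ "y' / of_nat d"])
      (simp add: cell_def x_def x'_def y_def right_diff_distrib)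
qed

lemma cell_shift:
  assumes "cell d s = cell d t"
  shows "cell d (s + of_int z) = cell d (t + of_int z)"
proof -
  have "of_nat d * (r + of_int z) = of_nat d * r + of_int (int d * z)" for r :: rat
    by (simp add: distrib_left)
  then show ?thesis
    using assms unfolding cell_def
    by (metis (no_types, lifting) ceiling_add_of_int floor_add_int prod.inject)
qed

section \<open>Constancy of the minimum model on cells\<close>

fun body_intervals :: "('p, 'v, 'c) body \<Rightarrow> rat set set" where
  "body_intervals (Conj As) = {}"
| "body_intervals (BoxMinus \<rho> A) = {\<rho>}"
| "body_intervals (DiamondMinus \<rho> A) = {\<rho>}"

lemma body_intervals_forward:
  "forward_body b \<Longrightarrow> \<rho> \<in> body_intervals b \<Longrightarrow> rat_interval \<rho> \<and> \<rho> \<subseteq> {0..}"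
  by (cases b) auto

lemma finite_body_intervals: "finite (body_intervals b)"
  by (cases b) auto

lemma finite_rule_atoms: "finite (rule_atoms r)"
  unfolding rule_atoms_def by (cases "body_of r") auto

lemma min_model_cell_invariant:
  assumes "d > 0"
    and prog: "\<And>r \<rho>. r \<in> \<Pi> \<Longrightarrow> \<rho> \<in> body_intervals (body_of r) \<Longrightarrow> saturated d \<rho>"
    and db: "\<And>A \<rho>. (A, \<rho>) \<in> D \<Longrightarrow> saturated d \<rho>"
    and "(A, t) \<in> min_model \<Pi> D" and "cell d t = cell d t'"
  shows "(A, t') \<in> min_model \<Pi> D"
proof -
  let ?M = "min_model \<Pi> D"
  \<comment> \<open>The largest subset of \<open>?M\<close> that is a union of cells for each
    atom.\<close>
  let ?N = "{(A, t). \<forall>t'. cell d t = cell d t' \<longrightarrow> (A, t') \<in> ?M}"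
  have M: "is_model \<Pi> D ?M"
    by (rule is_model_min_model)
  have "sat_rule ?N r" if r: "r \<in> \<Pi>" for r
    unfolding sat_rule_def
  proof (intro allI impI, clarify)
    fix \<sigma> t t'
    assume b: "sat_body ?N t \<sigma> (body_of r)" and c: "cell d t = cell d t'"
    \<comment> \<open>For a box, each offset at \<open>t'\<close> is pulled back to
      \<open>t\<close>; for a diamond, the witness at \<open>t\<close> is carried over to
      \<open>t'\<close>. The offset keeps its cell and hence stays in the saturated
      \<open>\<rho>\<close>.\<close>
    have "sat_body ?M t' \<sigma> (body_of r)"
    proof (cases "body_of r")
      case (Conj As)
      then show ?thesis using b c by auto
    next
      case (BoxMinus \<rho> A)
      have "(ground_atom \<sigma> A, s') \<in> ?M" if s': "t' - s' \<in> \<rho>" for s'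
      proof -
        obtain s where s: "cell d s = cell d s'" "cell d (t - s) = cell d (t' - s')"
          using cell_difference[of d t' t s'] c assms(1) by auto
        have "saturated d \<rho>"
          using prog[OF r, of \<rho>] BoxMinus by simp
        then have "t - s \<in> \<rho>"
          using saturatedD s(2) s' by metis
        then show ?thesis
          using b s(1) BoxMinus by simp
      qed
      then show ?thesis using BoxMinus by simp
    next
      case (DiamondMinus \<rho> A)
      then obtain s where s: "t - s \<in> \<rho>" "(ground_atom \<sigma> A, s) \<in> ?N"
        using b by auto
      obtain s' where s': "cell d s' = cell d s" "cell d (t' - s') = cell d (t - s)"
        using cell_difference[of d t t' s] c assms(1) by auto
      have "saturated d \<rho>"
        using prog[OF r, of \<rho>] DiamondMinus by simp
      then have "t' - s' \<in> \<rho>"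
        using saturatedD s(1) s'(2) by metis
      moreover have "(ground_atom \<sigma> A, s') \<in> ?M"
        using s(2) s'(1) by simp
      ultimately show ?thesis
        using DiamondMinus by auto
    qed
    then show "(ground_atom \<sigma> (head_of r), t') \<in> ?M"
      using M r by (auto simp: is_model_def sat_rule_def)
  qed
  moreover have "\<forall>(A, \<rho>)\<in>D. \<forall>t\<in>\<rho>. (A, t) \<in> ?N"
  proof clarify
    fix P \<tau> \<rho> t t'
    assume A: "((P, \<tau>), \<rho>) \<in> D" "t \<in> \<rho>" "cell d t = cell d t'"
    then have "t' \<in> \<rho>"
      using db saturatedD by metis
    then show "((P, \<tau>), t') \<in> ?M"
      using M A(1) by (auto simp: is_model_def)
  qed
  ultimately have "?M \<subseteq> ?N"
    by (intro min_model_least) (simp add: is_model_def)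
  then show ?thesis
    using assms(4,5) by auto
qed

section \<open>Renaming of constants and finiteness of the traces\<close>

definition atom_consts :: "('p, ('v, 'c) trm) atom \<Rightarrow> 'c set" where
  "atom_consts A = {c. Const c \<in> set (snd A)}"

lemma finite_atom_consts: "finite (atom_consts A)"
proof -
  have "atom_consts A = Const -` set (snd A)"
    by (auto simp: atom_consts_def)
  then show ?thesis
    by (simp add: finite_vimageI inj_def)
qed

lemma map_ground_atom:
  assumes "\<And>c. c \<in> atom_consts A \<Longrightarrow> \<pi> c = c"
  shows "map_prod id (map \<pi>) (ground_atom \<sigma> A) = ground_atom (\<pi> \<circ> \<sigma>) A"
proof -
  have "\<pi> (ground_trm \<sigma> x) = ground_trm (\<pi> \<circ> \<sigma>) x" if "x \<in> set (snd A)" for x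
    using assms that by (cases x) (auto simp: atom_consts_def)
  then show ?thesis by (simp add: ground_atom_def)
qed

text \<open>The preimage of the minimum model under \<open>\<pi>\<close> is again a model:
  \<open>\<pi>\<close> turns the instance of a rule under \<open>\<sigma>\<close> into the instance
  under \<open>\<pi> \<circ> \<sigma>\<close>. Bodies are positive, so \<open>\<pi>\<close> may even
  identify constants.\<close>

lemma min_model_map_const:
  assumes prog: "\<And>r A c. r \<in> \<Pi> \<Longrightarrow> A \<in> rule_atoms r \<Longrightarrow> c \<in> atom_consts A \<Longrightarrow> \<pi> c = c"
    and db: "\<And>A \<rho> c. (A, \<rho>) \<in> D \<Longrightarrow> c \<in> set (snd A) \<Longrightarrow> \<pi> c = c"
    and "(A, t) \<in> min_model \<Pi> D"
  shows "(map_prod id (map \<pi>) A, t) \<in> min_model \<Pi> D"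
proof -
  let ?M = "min_model \<Pi> D"
  let ?N = "{(A, t). (map_prod id (map \<pi>) A, t) \<in> ?M}"
  have M: "is_model \<Pi> D ?M"
    by (rule is_model_min_model)
  have "sat_rule ?N r" if r: "r \<in> \<Pi>" for r
    unfolding sat_rule_def
  proof (intro allI impI)
    fix \<sigma> t
    have g: "map_prod id (map \<pi>) (ground_atom \<sigma> A) = ground_atom (\<pi> \<circ> \<sigma>) A"
      if "A \<in> rule_atoms r" for A
      using map_ground_atom prog[OF r that] by blast
    assume "sat_body ?N t \<sigma> (body_of r)"
    then have "sat_body ?M t (\<pi> \<circ> \<sigma>) (body_of r)"
      using g by (cases "body_of r") (auto simp: rule_atoms_def)
    then have "(ground_atom (\<pi> \<circ> \<sigma>) (head_of r), t) \<in> ?M"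
      using M r by (auto simp: is_model_def sat_rule_def)
    then show "(ground_atom \<sigma> (head_of r), t) \<in> ?N"
      using g[of "head_of r"] by (simp add: rule_atoms_def)
  qed
  moreover have "\<forall>(A, \<rho>)\<in>D. \<forall>t\<in>\<rho>. (A, t) \<in> ?N"
  proof clarify
    fix P \<tau> \<rho> t
    assume A: "((P, \<tau>), \<rho>) \<in> D" "t \<in> \<rho>"
    then have "map_prod id (map \<pi>) (P, \<tau>) = (P, \<tau>)"
      using db by (auto intro: map_idI)
    then show "(map_prod id (map \<pi>) (P, \<tau>), t) \<in> ?M"
      using M A by (auto simp: is_model_def)
  qed
  ultimately have "?M \<subseteq> ?N"
    by (intro min_model_least) (simp add: is_model_def)
  then show ?thesis
    using assms(3) by auto
qed

definition pattern :: "'c set \<Rightarrow> 'c list \<Rightarrow> (nat \<times> nat) set \<times> (nat \<times> 'c) set" where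
  "pattern C \<tau> =
     ({(i, j). i < length \<tau> \<and> j < length \<tau> \<and> \<tau> ! i = \<tau> ! j},
      {(i, c). i < length \<tau> \<and> c \<in> C \<and> \<tau> ! i = c})"

lemma finite_patterns:
  assumes "finite C"
  shows "finite (pattern C ` {\<tau>. length \<tau> = n})"
proof (rule finite_subset)
  show "pattern C ` {\<tau>. length \<tau> = n} \<subseteq> Pow ({..<n} \<times> {..<n}) \<times> Pow ({..<n} \<times> C)"
    by (auto simp: pattern_def)
  show "finite (Pow ({..<n} \<times> {..<n}) \<times> Pow ({..<n} \<times> C))"
    using assms by simp
qed

lemma pattern_eq_map:
  assumes "length \<tau> = length \<tau>'" and "pattern C \<tau> = pattern C \<tau>'"
  obtains \<pi> where "map \<pi> \<tau> = \<tau>'" and "\<And>c. c \<in> C \<Longrightarrow> \<pi> c = c"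
proof
  \<comment> \<open>A constant outside \<open>C\<close> goes to the entry of \<open>\<tau>'\<close>
    at some position where \<open>\<tau>\<close> carries it; equal patterns make the position
    immaterial. Its value on constants outside \<open>C\<close> and \<open>\<tau>\<close> does not
    matter.\<close>
  define \<pi> where "\<pi> c = (if c \<in> C then c else \<tau>' ! (SOME i. i < length \<tau> \<and> \<tau> ! i = c))" for c
  have eq: "\<tau> ! i = \<tau> ! j \<longleftrightarrow> \<tau>' ! i = \<tau>' ! j" if "i < length \<tau>" "j < length \<tau>" for i j
    using assms that by (auto simp: pattern_def set_eq_iff)
  have C: "\<tau> ! i = c \<longleftrightarrow> \<tau>' ! i = c" if "i < length \<tau>" "c \<in> C" for i c
    using assms that by (auto simp: pattern_def set_eq_iff)
  show "map \<pi> \<tau> = \<tau>'"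
  proof (rule nth_equalityI)
    fix i
    assume "i < length (map \<pi> \<tau>)"
    then have i: "i < length \<tau>" by simp
    define j where "j = (SOME j. j < length \<tau> \<and> \<tau> ! j = \<tau> ! i)"
    have "j < length \<tau> \<and> \<tau> ! j = \<tau> ! i"
      unfolding j_def by (rule someI[of _ i]) (simp add: i)
    then have "\<tau>' ! j = \<tau>' ! i"
      using eq i by blast
    then have "\<pi> (\<tau> ! i) = \<tau>' ! i"
      using C[OF i, of "\<tau> ! i"] unfolding \<pi>_def j_def by auto
    then show "map \<pi> \<tau> ! i = \<tau>' ! i"
      using i by simp
  qed (simp add: assms)
  show "\<pi> c = c" if "c \<in> C" for c
    using that by (simp add: \<pi>_def)
qed

definition trace :: "('p, 'c) interp \<Rightarrow> ('p, 'c) atom \<Rightarrow> rat set" where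
  "trace M A = {t. (A, t) \<in> M}"

text \<open>Letting all atoms of the right arity over the occurring predicates hold always gives a
  model. This leaves finitely many predicates and bounds the tuple lengths, as counting patterns
  requires.\<close>

lemma min_model_wf:
  assumes "fp_program ar \<Pi>" and "database ar D" and "(A, t) \<in> min_model \<Pi> D"
  shows "wf_atom ar A" and "fst A \<in> program_preds \<Pi> \<union> (fst \<circ> fst) ` D"
proof -
  let ?N = "{(A, t :: rat). wf_atom ar A \<and> fst A \<in> program_preds \<Pi> \<union> (fst \<circ> fst) ` D}"
  have "is_model \<Pi> D ?N"
    unfolding is_model_def
  proof (intro conjI ballI)
    fix r
    assume r: "r \<in> \<Pi>"
    then have "wf_atom ar (head_of r)" "fst (head_of r) \<in> program_preds \<Pi>"
      using assms(1) by (auto simp: fp_program_def rule_atoms_def program_preds_def)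
    then show "sat_rule ?N r"
      by (auto simp: sat_rule_def ground_atom_def wf_atom_def)
  next
    fix x
    assume "x \<in> D"
    then show "case x of (A, \<rho>) \<Rightarrow> \<forall>t\<in>\<rho>. (A, t) \<in> ?N"
      using assms(2) by (force simp: database_def)
  qed
  then show "wf_atom ar A" "fst A \<in> program_preds \<Pi> \<union> (fst \<circ> fst) ` D"
    using min_model_least assms(3) by blast+
qed

lemma finite_traces:
  assumes "fp_program ar \<Pi>" and "database ar D"
  shows "finite (range (trace (min_model \<Pi> D)))"
proof -
  let ?M = "min_model \<Pi> D"
  define C where "C = (\<Union>r\<in>\<Pi>. \<Union>A\<in>rule_atoms r. atom_consts A) \<union> (\<Union>x\<in>D. set (snd (fst x)))"
  define R where "R = program_preds \<Pi> \<union> (fst \<circ> fst) ` D"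
  have "finite \<Pi>" "finite D"
    using assms by (auto simp: fp_program_def database_def)
  then have C: "finite C" and R: "finite R"
    by (auto simp: C_def R_def program_preds_def finite_atom_consts finite_rule_atoms)
  have step: "((Q, \<tau>'), t) \<in> ?M"
    if eq: "length \<tau> = length \<tau>'" "pattern C \<tau> = pattern C \<tau>'" "((Q, \<tau>), t) \<in> ?M" for Q \<tau> \<tau>' t
  proof -
    obtain \<pi> where \<pi>: "map \<pi> \<tau> = \<tau>'" "\<And>c. c \<in> C \<Longrightarrow> \<pi> c = c"
      using pattern_eq_map[OF eq(1,2)] by blast
    have "(map_prod id (map \<pi>) (Q, \<tau>), t) \<in> ?M"
      by (rule min_model_map_const) (use \<pi>(2) eq(3) in \<open>force simp: C_def\<close>)+
    then show ?thesis using \<pi>(1) by simp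
  qed
  define S where "S = (SIGMA Q:R. pattern C ` {\<tau>. length \<tau> = ar Q})"
  \<comment> \<open>The trace of an arbitrary representative of a predicate and pattern; atoms that
    never hold are covered by the empty trace.\<close>
  define f where "f x = trace ?M (fst x, SOME \<tau>. length \<tau> = ar (fst x) \<and> pattern C \<tau> = snd x)" for x
  have "trace ?M A \<in> insert {} (f ` S)" for A
  proof (cases "trace ?M A = {}")
    case False
    obtain Q \<tau> where A: "A = (Q, \<tau>)" by (cases A)
    with False obtain t where "((Q, \<tau>), t) \<in> ?M"
      by (auto simp: trace_def)
    then have wf: "length \<tau> = ar Q" "Q \<in> R"
      using min_model_wf[OF assms] unfolding wf_atom_def R_def by fastforce+
    define \<tau>' where "\<tau>' = (SOME \<tau>'. length \<tau>' = ar Q \<and> pattern C \<tau>' = pattern C \<tau>)"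
    have "length \<tau>' = ar Q \<and> pattern C \<tau>' = pattern C \<tau>"
      unfolding \<tau>'_def by (rule someI[of _ \<tau>]) (simp add: wf)
    \<comment> \<open>Renaming in each of the two directions gives one inclusion.\<close>
    then have "trace ?M A = trace ?M (Q, \<tau>')"
      using step[of \<tau> \<tau>'] step[of \<tau>' \<tau>] wf by (auto simp: trace_def A)
    then have "trace ?M A = f (Q, pattern C \<tau>)"
      by (simp add: f_def \<tau>'_def)
    then show ?thesis
      using wf by (auto simp: S_def)
  qed simp
  then have "range (trace ?M) \<subseteq> insert {} (f ` S)"
    by blast
  moreover have "finite S"
    unfolding S_def using R finite_patterns[OF C] by (rule finite_SigmaI)
  ultimately show ?thesis
    by (meson finite_imageI finite_insert finite_subset)
qed

section \<open>Gluing a past to a shifted future\<close>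

text \<open>The shift \<open>q\<close> may be negative; the two signs give the two inclusions between the futures.\<close>

lemma min_model_shift:
  assumes prog: "\<And>r. r \<in> \<Pi> \<Longrightarrow> forward_body (body_of r)"
    and tail: "\<And>r \<rho>. r \<in> \<Pi> \<Longrightarrow> \<rho> \<in> body_intervals (body_of r) \<Longrightarrow> \<rho> \<subseteq> {..<w} \<or> {w..} \<subseteq> \<rho>"
    and db: "\<And>A \<rho>. (A, \<rho>) \<in> D \<Longrightarrow> \<rho> \<subseteq> {..<K} \<or> {K..} \<subseteq> \<rho>"
    and once: "\<And>A t. (A, t) \<in> min_model \<Pi> D \<Longrightarrow> \<exists>s\<le>K. (A, s) \<in> min_model \<Pi> D"
    and never: "\<And>A t. (A, t) \<notin> min_model \<Pi> D \<Longrightarrow> \<exists>s\<le>K. (A, s) \<notin> min_model \<Pi> D"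
    and pos: "w > 0" "K + w \<le> k" "K + w \<le> k + q"
    and window: "\<And>A s. k - w \<le> s \<Longrightarrow> s < k \<Longrightarrow>
      (A, s) \<in> min_model \<Pi> D \<longleftrightarrow> (A, s + q) \<in> min_model \<Pi> D"
    and late: "k \<le> t" "(A, t) \<in> min_model \<Pi> D"
  shows "(A, t + q) \<in> min_model \<Pi> D"
proof -
  define M where "M = min_model \<Pi> D"
  define H where "H = {(A, s). (A, if s < k then s else s + q) \<in> M}"
  have M: "is_model \<Pi> D M"
    unfolding M_def by (rule is_model_min_model)
  have old: "(A, s) \<in> H \<longleftrightarrow> (A, s) \<in> M" if "s < k" for A s
    using that by (simp add: H_def)
  \<comment> \<open>Since the windows agree, the shifted description of \<open>H\<close> is valid
    already from \<open>k - w\<close> on and overlaps there with \<open>old\<close>.\<close>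
  have new: "(A, s) \<in> H \<longleftrightarrow> (A, s + q) \<in> M" if "k - w \<le> s" for A s
    using that window by (auto simp: H_def M_def)
  have "sat_rule H r" if r: "r \<in> \<Pi>" for r
    unfolding sat_rule_def
  proof (intro allI impI)
    fix \<sigma> t
    assume b: "sat_body H t \<sigma> (body_of r)"
    show "(ground_atom \<sigma> (head_of r), t) \<in> H"
    proof (cases "t < k")
      case True
      \<comment> \<open>Forward propagation: before \<open>k\<close> a rule looks only at times
        before \<open>k\<close>, where \<open>H\<close> and \<open>M\<close> agree.\<close>
      have nonneg: "0 \<le> x" if "x \<in> \<rho>" "\<rho> \<in> body_intervals (body_of r)" for x \<rho>
        using body_intervals_forward[OF prog[OF r]] that by auto
      have "sat_body M t \<sigma> (body_of r)"
      proof (cases "body_of r")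
        case (Conj As)
        then show ?thesis using b old[OF True] by auto
      next
        case (BoxMinus \<rho> A)
        then have "t - s \<in> \<rho> \<Longrightarrow> s < k" for s
          using nonneg[of "t - s" \<rho>] True by auto
        then show ?thesis using b old BoxMinus by auto
      next
        case (DiamondMinus \<rho> A)
        then have "t - s \<in> \<rho> \<Longrightarrow> s < k" for s
          using nonneg[of "t - s" \<rho>] True by auto
        then show ?thesis
          using b old unfolding DiamondMinus sat_body.simps by blast
      qed
      then have "(ground_atom \<sigma> (head_of r), t) \<in> M"
        using M r by (auto simp: is_model_def sat_rule_def)
      then show ?thesis
        unfolding old[OF True] .
    next
      case False
      have "sat_body M (t + q) \<sigma> (body_of r)"
      proof (cases "body_of r")
        case (Conj As)
        then show ?thesis using b new[of t] False pos by auto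
      next
        case (BoxMinus \<rho> A)
        then have box: "(ground_atom \<sigma> A, s) \<in> H" if "t - s \<in> \<rho>" for s
          using b that by simp
        have "(ground_atom \<sigma> A, s) \<in> M" if s: "t + q - s \<in> \<rho>" for s
        proof (cases "k - w \<le> s - q")
          case True
          have "t - (s - q) \<in> \<rho>"
            using s by (simp add: algebra_simps)
          then have "(ground_atom \<sigma> A, s - q) \<in> H"
            by (rule box)
          then show ?thesis
            unfolding new[OF True] by simp
        next
          \<comment> \<open>The offset exceeds \<open>w\<close>, so \<open>\<rho>\<close> contains
            all of \<open>{w..}\<close> and the box at \<open>t\<close> covers every time up to
            \<open>K\<close>. By \<open>never\<close>, an atom holding at all these times holds
            always.\<close>
          case far: False
          have "{w..} \<subseteq> \<rho>"
            using tail[OF r, of \<rho>] BoxMinus s far False by force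
          moreover have "s0 < k \<and> w \<le> t - s0" if "s0 \<le> K" for s0
            using that pos False by linarith
          ultimately have "(ground_atom \<sigma> A, s0) \<in> M" if "s0 \<le> K" for s0
            using that box old by (meson atLeast_iff subsetD)
          then show ?thesis
            using never unfolding M_def by blast
        qed
        then show ?thesis using BoxMinus by simp
      next
        case (DiamondMinus \<rho> A)
        then obtain s where s: "t - s \<in> \<rho>" "(ground_atom \<sigma> A, s) \<in> H"
          using b by auto
        show ?thesis
        proof (cases "k - w \<le> s")
          case True
          then have "(ground_atom \<sigma> A, s + q) \<in> M"
            using new s by blast
          then show ?thesis
            using s DiamondMinus by (auto intro!: exI[of _ "s + q"])
        next
          case far: False
          then have "s < k"
            using pos(1) by simp
          then have "(ground_atom \<sigma> A, s) \<in> M"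
            using s(2) old by blast
          \<comment> \<open>The distant witness is replaced by one not after \<open>K\<close>. Its
            offset from \<open>t + q\<close> is at least \<open>w\<close>, and \<open>\<rho>\<close>
            contains all such offsets.\<close>
          then obtain s0 where s0: "s0 \<le> K" "(ground_atom \<sigma> A, s0) \<in> M"
            using once unfolding M_def by blast
          have "{w..} \<subseteq> \<rho>"
            using tail[OF r, of \<rho>] DiamondMinus s far False by force
          then have "t + q - s0 \<in> \<rho>"
            using s0 pos False by auto
          then show ?thesis
            using s0 DiamondMinus by auto
        qed
      qed
      then have "(ground_atom \<sigma> (head_of r), t + q) \<in> M"
        using M r by (auto simp: is_model_def sat_rule_def)
      then show ?thesis
        using new[of t "ground_atom \<sigma> (head_of r)"] False pos by simp
    qed
  qed
  moreover have "\<forall>(A, \<rho>)\<in>D. \<forall>t\<in>\<rho>. (A, t) \<in> H"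
  proof clarify
    fix P \<tau> \<rho> t
    assume A: "((P, \<tau>), \<rho>) \<in> D" "t \<in> \<rho>"
    \<comment> \<open>A database interval reaching \<open>k\<close> contains everything from
      \<open>K\<close> on, hence also \<open>t + q\<close>.\<close>
    then have "(if t < k then t else t + q) \<in> \<rho>"
      using db[OF A(1)] pos by force
    then show "((P, \<tau>), t) \<in> H"
      using M A(1) by (auto simp: is_model_def H_def)
  qed
  ultimately have "min_model \<Pi> D \<subseteq> H"
    by (intro min_model_least) (simp add: is_model_def)
  then have "(A, t) \<in> H"
    using late(2) by blast
  then show ?thesis
    using late(1) by (simp add: H_def M_def)
qed

section \<open>Repetition of windows and periodicity\<close>

lemma finite_cells: "finite (cell d ` {a..b})"
proof (rule finite_subset)
  show "cell d ` {a..b} \<subseteq> {\<lfloor>of_nat d * a\<rfloor>..\<lfloor>of_nat d * b\<rfloor>} \<times> {\<lceil>of_nat d * a\<rceil>..\<lceil>of_nat d * b\<rceil>}"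
    by (auto simp: cell_def intro!: floor_mono ceiling_mono mult_left_mono)
qed simp

lemma finite_bounded_witnesses:
  fixes \<T> :: "rat set set"
  assumes "finite \<T>"
  shows "\<exists>K. \<forall>v\<ge>K. \<forall>S\<in>\<T>. S \<noteq> {} \<longrightarrow> (\<exists>s\<le>v. s \<in> S)"
proof (rule finite_uniform_bound[OF assms])
  fix S :: "rat set"
  show "\<exists>w. \<forall>v\<ge>w. S \<noteq> {} \<longrightarrow> (\<exists>s\<le>v. s \<in> S)"
    by (metis ex_in_conv)
qed

lemma min_model_eventually_periodic:
  assumes "fp_program ar \<Pi>" and "database ar D"
  shows "\<exists>(T::rat) (n::nat). n > 0 \<and>
    (\<forall>A t. t \<ge> T \<longrightarrow> (A, t + of_nat n) \<in> min_model \<Pi> D \<longleftrightarrow> (A, t) \<in> min_model \<Pi> D)"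
proof -
  define M where "M = min_model \<Pi> D"
  define \<T> where "\<T> = range (trace M)"
  have \<T>: "finite \<T>"
    unfolding \<T>_def M_def using finite_traces[OF assms] .
  have fwd: "forward_body (body_of r)" if "r \<in> \<Pi>" for r
    using that assms(1) by (auto simp: fp_program_def)
  define \<I> where "\<I> = (\<Union>r\<in>\<Pi>. body_intervals (body_of r))"
  define \<J> where "\<J> = snd ` D"
  have fin: "finite \<I>" "finite \<J>"
    using assms by (auto simp: \<I>_def \<J>_def fp_program_def database_def finite_body_intervals)
  have int: "\<forall>I\<in>\<I>. rat_interval I" "\<forall>I\<in>\<J>. rat_interval I"
    using body_intervals_forward[OF fwd] assms(2) by (auto simp: \<I>_def \<J>_def database_def)
  obtain d where d: "d > 0" "\<forall>I\<in>\<I> \<union> \<J>. saturated d I"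
    using common_saturation[of "\<I> \<union> \<J>"] fin int by auto
  have inv: "(A, t) \<in> M \<longleftrightarrow> (A, t') \<in> M" if "cell d t = cell d t'" for A t t'
  proof -
    have "(A, v) \<in> M" if "cell d u = cell d v" "(A, u) \<in> M" for u v
      unfolding M_def
      by (rule min_model_cell_invariant[where t = u and d = d])
        (use d that in \<open>force simp: \<I>_def \<J>_def M_def\<close>)+
    with that show ?thesis by metis
  qed
  obtain w0 where w0: "\<forall>v\<ge>w0. \<forall>\<rho>\<in>\<I>. \<rho> \<subseteq> {..<v} \<or> {v..} \<subseteq> \<rho>"
    using finite_uniform_bound[OF fin(1), of "\<lambda>\<rho> v. \<rho> \<subseteq> {..<v} \<or> {v..} \<subseteq> \<rho>"]
      rat_interval_tail int(1) by blast
  obtain K0 where K0: "\<forall>v\<ge>K0. \<forall>\<rho>\<in>\<J>. \<rho> \<subseteq> {..<v} \<or> {v..} \<subseteq> \<rho>"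
    using finite_uniform_bound[OF fin(2), of "\<lambda>\<rho> v. \<rho> \<subseteq> {..<v} \<or> {v..} \<subseteq> \<rho>"]
      rat_interval_tail int(2) by blast
  \<comment> \<open>Including the complements of traces yields \<open>never\<close> along with
    \<open>once\<close>.\<close>
  obtain K1 where K1: "\<forall>v\<ge>K1. \<forall>S\<in>\<T> \<union> uminus ` \<T>. S \<noteq> {} \<longrightarrow> (\<exists>s\<le>v. s \<in> S)"
    using finite_bounded_witnesses[of "\<T> \<union> uminus ` \<T>"] \<T> by auto
  define w where "w = max 1 w0"
  define K where "K = max K0 K1"
  have once: "\<exists>s\<le>K. (A, s) \<in> M" if "(A, t) \<in> M" for A t
  proof -
    have "trace M A \<in> \<T> \<union> uminus ` \<T>" "trace M A \<noteq> {}"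
      using that by (auto simp: \<T>_def trace_def)
    then have "\<exists>s\<le>K. s \<in> trace M A"
      using K1 unfolding K_def by (metis max.cobounded2)
    then show ?thesis by (simp add: trace_def)
  qed
  have never: "\<exists>s\<le>K. (A, s) \<notin> M" if "(A, t) \<notin> M" for A t
  proof -
    have "- trace M A \<in> \<T> \<union> uminus ` \<T>" "- trace M A \<noteq> {}"
      using that by (auto simp: \<T>_def trace_def)
    then have "\<exists>s\<le>K. s \<in> - trace M A"
      using K1 unfolding K_def by (metis max.cobounded2)
    then show ?thesis by (simp add: trace_def)
  qed
  \<comment> \<open>From here on, windows of length \<open>w\<close> start no earlier than
    \<open>K\<close>. Integer positions make a move from one window to another preserve equality of
    cells.\<close>
  define base :: int where "base = \<lceil>K + w\<rceil>"
  \<comment> \<open>The content of the window, recording traces instead of atoms and relative cells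
    instead of times. Only finitely many values are thus possible, even with infinitely many
    constants.\<close>
  define W where "W i = {(trace M A, cell d (s - of_int (base + int i))) | A s.
    (A, s) \<in> M \<and> of_int (base + int i) - w \<le> s \<and> s < of_int (base + int i)}" for i :: nat
  have "range W \<subseteq> Pow (\<T> \<times> cell d ` {- w..0})"
    by (force simp: W_def \<T>_def)
  then have "finite (range W)"
    by (rule finite_subset) (simp add: \<T> finite_cells)
  then have "\<not> inj W"
    using finite_imageD infinite_UNIV_nat by blast
  then obtain i j where ij: "i < j" "W i = W j"
    unfolding inj_def by (metis linorder_neqE_nat)
  define k1 k2 :: int where "k1 = base + int i" and "k2 = base + int j"
  define n where "n = j - i"
  have n: "n > 0" "k2 = k1 + int n"
    using ij by (auto simp: n_def k1_def k2_def)
  have transfer: "(A, s + of_int (l2 - l1)) \<in> M"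
    if W: "W i1 = W i2" and l: "l1 = base + int i1" "l2 = base + int i2"
      and s: "of_int l1 - w \<le> s" "s < of_int l1" "(A, s) \<in> M" for A s i1 i2 l1 l2
  proof -
    have "(trace M A, cell d (s - of_int l1)) \<in> W i1"
      unfolding W_def using s l(1) by blast
    then have "(trace M A, cell d (s - of_int l1)) \<in> W i2"
      by (simp only: W)
    then obtain A' s' where *: "trace M A = trace M A'" "cell d (s - of_int l1) = cell d (s' - of_int l2)"
      "(A', s') \<in> M"
      using l by (auto simp: W_def)
    \<comment> \<open>The entry found in the other window may come from another atom
      \<open>A'\<close>, but equal traces make \<open>A\<close> hold at \<open>s'\<close> too, and
      \<open>inv\<close> moves this to the exact shifted time.\<close>
    have "cell d (s + of_int (l2 - l1)) = cell d s'"
      using cell_shift[OF *(2), of l2] by (simp add: algebra_simps)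
    moreover have "(A, s') \<in> M"
      using * by (auto simp: trace_def)
    ultimately show ?thesis
      using inv by blast
  qed
  have low: "K + w \<le> of_int k1" "K + w \<le> of_int k2"
  proof -
    have "K + w \<le> of_int base"
      unfolding base_def by (rule le_of_int_ceiling)
    then show "K + w \<le> of_int k1" "K + w \<le> of_int k2"
      by (auto simp: k1_def k2_def)
  qed
  have window: "(A, s) \<in> M \<longleftrightarrow> (A, s + of_nat n) \<in> M"
    if "of_int k1 - w \<le> s" "s < of_int k1" for A s
    using transfer[OF ij(2) k1_def k2_def that, of A]
      transfer[OF ij(2)[symmetric] k2_def k1_def, of "s + of_nat n" A] that
    by (auto simp: n(2))
  have tail: "\<rho> \<subseteq> {..<w} \<or> {w..} \<subseteq> \<rho>" if "r \<in> \<Pi>" "\<rho> \<in> body_intervals (body_of r)" for r \<rho>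
    using w0 that by (auto simp: w_def \<I>_def)
  have db: "\<rho> \<subseteq> {..<K} \<or> {K..} \<subseteq> \<rho>" if "(A, \<rho>) \<in> D" for A \<rho>
    using K0 that by (force simp: K_def \<J>_def)
  have "w > 0" by (simp add: w_def)
  have "(A, t + of_nat n) \<in> M" if "of_int k1 \<le> t" "(A, t) \<in> M" for A t
    unfolding M_def
    by (rule min_model_shift[where k = "of_int k1", OF fwd tail db])
      (use once never low \<open>w > 0\<close> window that n in \<open>simp_all add: M_def\<close>)
  moreover have "(A, t) \<in> M" if "of_int k1 \<le> t" "(A, t + of_nat n) \<in> M" for A t
  proof -
    \<comment> \<open>Gluing at \<open>k2\<close> with shift \<open>- of_nat n\<close>: the past
      before \<open>k2\<close> is continued by the future from \<open>k1\<close>.\<close>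
    have "(A, t + of_nat n + (- of_nat n)) \<in> M"
      unfolding M_def
    proof (rule min_model_shift[where k = "of_int k2" and w = w and K = K, OF fwd tail db])
      fix A s
      assume "of_int k2 - w \<le> s" "s < of_int k2"
      then show "(A, s) \<in> min_model \<Pi> D \<longleftrightarrow> (A, s + - of_nat n) \<in> min_model \<Pi> D"
        using window[of "s - of_nat n" A] by (simp add: n(2) M_def)
    qed (use once never low \<open>w > 0\<close> that n in \<open>simp_all add: M_def\<close>)
    then show ?thesis by simp
  qed
  ultimately show ?thesis
    using n(1) unfolding M_def by blast
qed

theorem theorem4:
  fixes ar :: "'p \<Rightarrow> nat"
    and \<Pi> :: "('p, 'v, 'c) mtl_rule set"
    and D :: "(('p, 'c) atom \<times> rat set) set"
    and P :: 'p
  assumes "fp_program ar \<Pi>"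
    and "database ar D"
    and "P \<in> program_preds \<Pi>"
  shows "\<exists>(T::rat) (n::nat). n > 0 \<and>
    (\<forall>(x::nat) (\<tau>::'c list). length \<tau> = ar P \<longrightarrow>
      (((P, \<tau>), T + of_nat n * of_nat x) \<in> min_model \<Pi> D \<longleftrightarrow> ((P, \<tau>), T) \<in> min_model \<Pi> D))"
proof -
  obtain T :: rat and n :: nat where n: "n > 0"
    and per: "\<And>A t. t \<ge> T \<Longrightarrow>
      (A, t + of_nat n) \<in> min_model \<Pi> D \<longleftrightarrow> (A, t) \<in> min_model \<Pi> D"
    using min_model_eventually_periodic[OF assms(1,2)] by blast
  \<comment> \<open>One \<open>T\<close> and one \<open>n\<close> serve all atoms; it remains to
    iterate the period, never going below \<open>T\<close>.\<close>
  have "(A, T + of_nat n * of_nat x) \<in> min_model \<Pi> D \<longleftrightarrow> (A, T) \<in> min_model \<Pi> D" for A x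
  proof (induction x)
    case (Suc x)
    then show ?case
      using per[of "T + of_nat n * of_nat x" A] by (simp add: algebra_simps)
  qed simp
  then show ?thesis
    using n by blast
qed

end
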